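(* Let $\Gamma$ be a finite abelian group with character table $\mathcal C$ and let $\pi\in Sym(\widehat\Gamma)$. Let $\psi_{a,b}$ denote the $(a,b)$ entry of the quantum Latin square $\Psi^\Gamma_\pi$. Then the following are equivalent: (1) the entries of the quantum permutation matrix $\mathcal P=(\psi_{a,b}\psi_{a,b}^\dagger)_{a,b\in\Gamma}$ commute; (2) there exist $\sigma\in\mathrm{Aut}(\Gamma)$ and $z\in\widehat\Gamma$ such that $\pi(x)=z\hat\sigma(x)$ for all $x\in\widehat\Gamma$; (3) the characteristic matrix $D^\pi$ is a permutation matrix. In the case that these hold, $D^\pi=P^{\sigma^{-1}}=(P^\sigma)^T$, with $\sigma$ as in (2).
   Context: For a finite abelian group $\Gamma$, $\widehat\Gamma$ is the group of characters $\chi:\Gamma\to S^1\subset\mathbb C$ under pointwise multiplication, and $Sym(\widehat\Gamma)$ is the group of all permutations of the set $\widehat\Gamma$. The character table $\mathcal C$ is the $\widehat\Gamma\times\Gamma$ matrix with $(\chi,a)$-entry $\chi(a)$. $e_a$, $e_\chi$ denote standard basis vectors. For a permutation $\rho$ of a finite set, $P^\rho$ is the permutation matrix sending $e_x$ to $e_{\rho(x)}$. $\circ$ between vectors denotes the entrywise product, and the overline entrywise complex conjugation. For $\sigma\in\mathrm{Aut}(\Gamma)$, $\hat\sigma\in\mathrm{Aut}(\widehat\Gamma)$ is defined by $\hat\sigma(\chi)=\chi\circ\sigma$. $\Psi^\Gamma_\pi=(\psi_{a,b})_{a,b\in\Gamma}$ is the array of vectors $\psi_{a,b}=\frac{1}{\sqrt{|\Gamma|}}(P^\pi\mathcal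 Ce_a)\circ(\overline{\mathcal Ce_b})\in\mathbb C^{\widehat\Gamma}$; it is a quantum Latin square (the vectors in every row and every column form an orthonormal basis). Hence $(\psi_{a,b}\psi_{a,b}^\dagger)_{a,b}$ is a quantum permutation matrix: its entries are projections and each row and column sums to the identity. The correlation $q^\Gamma_\pi$ is given by $q^\Gamma_\pi(a,b|c,d)=\frac1{|\Gamma|}|\langle\psi_{c,a},\psi_{d,b}\rangle|^2$. Its value $q^\Gamma_\pi(w,x|y,z)$ depends only on $w^{-1}x$ and $y^{-1}z$. The characteristic matrix $D^\pi$ is the $\Gamma\times\Gamma$ matrix whose $(a,b)$ entry is $|\Gamma|\,q^\Gamma_\pi(w,x|y,z)$ for any $w,x,y,z\in\Gamma$ with $w^{-1}x=a$ and $y^{-1}z=b$. *)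

theory Defs
  imports Complex_Main "HOL-Algebra.Algebra"
begin

section \<open>Vectors and matrices indexed by finite sets\<close>

text \<open>
  A vector indexed by a finite set \<open>I\<close> is a function of which only the values on \<open>I\<close> matter, and a
  matrix with rows indexed by \<open>I\<close> and columns by \<open>J\<close> is a function of two arguments of which only
  the values on \<open>I \<times> J\<close> matter.  Accordingly, equality of matrices is relative to \<open>I\<close> and \<open>J\<close>.
\<close>

definition eq_mat :: "'i set \<Rightarrow> 'j set \<Rightarrow> ('i \<Rightarrow> 'j \<Rightarrow> 'c) \<Rightarrow> ('i \<Rightarrow> 'j \<Rightarrow> 'c) \<Rightarrow> bool" where
  "eq_mat I J A B \<longleftrightarrow> (\<forall>i\<in>I. \<forall>j\<in>J. A i j = B i j)"

definition mat_vec :: "'j set \<Rightarrow> ('i \<Rightarrow> 'j \<Rightarrow> complex) \<Rightarrow> ('j \<Rightarrow> complex) \<Rightarrow> ('i \<Rightarrow> complex)" where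
  "mat_vec J A v = (\<lambda>i. \<Sum>j\<in>J. A i j * v j)"

definition mat_mult ::
    "'j set \<Rightarrow> ('i \<Rightarrow> 'j \<Rightarrow> complex) \<Rightarrow> ('j \<Rightarrow> 'k \<Rightarrow> complex) \<Rightarrow> ('i \<Rightarrow> 'k \<Rightarrow> complex)" where
  "mat_mult J A B = (\<lambda>i k. \<Sum>j\<in>J. A i j * B j k)"

definition mat_transp :: "('i \<Rightarrow> 'j \<Rightarrow> 'c) \<Rightarrow> ('j \<Rightarrow> 'i \<Rightarrow> 'c)" where
  "mat_transp A = (\<lambda>j i. A i j)"

definition std_basis :: "'i \<Rightarrow> ('i \<Rightarrow> complex)" where
  "std_basis a = (\<lambda>i. if i = a then 1 else 0)"

definition entrywise_prod :: "('i \<Rightarrow> complex) \<Rightarrow> ('i \<Rightarrow> complex) \<Rightarrow> ('i \<Rightarrow> complex)" where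
  "entrywise_prod u v = (\<lambda>i. u i * v i)"

definition cnj_vec :: "('i \<Rightarrow> complex) \<Rightarrow> ('i \<Rightarrow> complex)" where
  "cnj_vec v = (\<lambda>i. cnj (v i))"

definition inner_prod :: "'i set \<Rightarrow> ('i \<Rightarrow> complex) \<Rightarrow> ('i \<Rightarrow> complex) \<Rightarrow> complex" where
  "inner_prod I u v = (\<Sum>i\<in>I. cnj (u i) * v i)"

text \<open>The rank-one matrix \<open>v v\<^sup>\<dagger>\<close>.\<close>

definition outer_self :: "('i \<Rightarrow> complex) \<Rightarrow> ('i \<Rightarrow> 'i \<Rightarrow> complex)" where
  "outer_self v = (\<lambda>i j. v i * cnj (v j))"

text \<open>The matrix that sends the basis vector of \<open>x\<close> to the basis vector of \<open>\<rho> x\<close>.\<close>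

definition perm_mat :: "('i \<Rightarrow> 'i) \<Rightarrow> ('i \<Rightarrow> 'i \<Rightarrow> 'c::zero_neq_one)" where
  "perm_mat \<rho> = (\<lambda>y x. if y = \<rho> x then 1 else 0)"

definition is_perm_mat :: "'i set \<Rightarrow> ('i \<Rightarrow> 'i \<Rightarrow> 'c::zero_neq_one) \<Rightarrow> bool" where
  "is_perm_mat I A \<longleftrightarrow> (\<exists>\<rho>. bij_betw \<rho> I I \<and> eq_mat I I A (perm_mat \<rho>))"

lemma mat_vec_std_basis:
  assumes "finite J" "a \<in> J"
  shows "mat_vec J A (std_basis a) = (\<lambda>i. A i a)"
  using assms by (simp add: mat_vec_def std_basis_def if_distrib cong: if_cong)

lemma mat_vec_perm_mat:
  assumes "finite I" "bij_betw \<rho> I I" "y \<in> I"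
  shows "mat_vec I (perm_mat \<rho>) v y = v (inv_into I \<rho> y)"
proof -
  have "(y = \<rho> x) = (x = inv_into I \<rho> y)" if "x \<in> I" for x
    using assms that by (auto simp: bij_betw_inv_into_left bij_betw_inv_into_right)
  then have "mat_vec I (perm_mat \<rho>) v y = (\<Sum>x\<in>I. if x = inv_into I \<rho> y then v x else 0)"
    unfolding mat_vec_def perm_mat_def by (intro sum.cong) auto
  moreover have "inv_into I \<rho> y \<in> I"
    using assms by (metis bij_betw_def inv_into_into)
  ultimately show ?thesis
    using assms(1) by simp
qed


section \<open>The character group\<close>

definition circle_group :: "complex monoid" where
  "circle_group = \<lparr>carrier = {w. cmod w = 1}, monoid.mult = (*), one = 1\<rparr>"

text \<open>
  Characters are taken to be extensional (\<open>undefined\<close> outside the carrier of the group), so that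
  each character is represented by exactly one HOL function, as the library does for
  automorphisms in \<^const>\<open>auto\<close>.
\<close>

definition dual_group :: "('a, 'm) monoid_scheme \<Rightarrow> ('a \<Rightarrow> complex) monoid" where
  "dual_group G =
     \<lparr>carrier = hom G circle_group \<inter> extensional (carrier G),
      monoid.mult = (\<lambda>\<chi> \<eta>. \<lambda>a\<in>carrier G. \<chi> a * \<eta> a),
      one = (\<lambda>a\<in>carrier G. 1)\<rparr>"

definition char_table :: "('a \<Rightarrow> complex) \<Rightarrow> 'a \<Rightarrow> complex" where
  "char_table = (\<lambda>\<chi> a. \<chi> a)"

definition dual_auto ::
    "('a, 'm) monoid_scheme \<Rightarrow> ('a \<Rightarrow> 'a) \<Rightarrow> ('a \<Rightarrow> complex) \<Rightarrow> ('a \<Rightarrow> complex)" where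
  "dual_auto G \<sigma> = (\<lambda>\<chi>\<in>carrier (dual_group G). compose (carrier G) \<chi> \<sigma>)"

lemma comm_group_circle_group: "comm_group circle_group"
proof (rule comm_groupI)
  fix x assume x: "x \<in> carrier circle_group"
  then have "inverse x \<in> carrier circle_group" "inverse x * x = 1"
    by (auto simp: circle_group_def norm_inverse intro!: left_inverse)
  then show "\<exists>y\<in>carrier circle_group. y \<otimes>\<^bsub>circle_group\<^esub> x = \<one>\<^bsub>circle_group\<^esub>"
    by (auto simp: circle_group_def)
qed (auto simp: circle_group_def norm_mult)

context comm_group
begin

lemma dual_mult: "\<chi> (a \<otimes> b) = \<chi> a * \<chi> b"
  if "\<chi> \<in> carrier (dual_group G)" "a \<in> carrier G" "b \<in> carrier G"
  using that by (simp add: dual_group_def hom_def circle_group_def)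

lemma dual_norm: "cmod (\<chi> a) = 1"
  if "\<chi> \<in> carrier (dual_group G)" "a \<in> carrier G"
  using that by (auto simp add: dual_group_def hom_def circle_group_def)

lemma dual_one: "\<chi> \<one> = 1" if "\<chi> \<in> carrier (dual_group G)"
proof -
  have "\<chi> \<one> \<noteq> 0"
    using dual_norm[OF that one_closed] by auto
  then show ?thesis
    using dual_mult[OF that one_closed one_closed] by simp
qed

lemma dual_inv: "\<chi> (inv a) = cnj (\<chi> a)"
  if "\<chi> \<in> carrier (dual_group G)" "a \<in> carrier G"
proof -
  have "\<chi> a * \<chi> (inv a) = 1"
    using that dual_mult[OF that(1), of a "inv a"] by (simp add: dual_one)
  moreover have "\<chi> a * cnj (\<chi> a) = 1"
    using dual_norm[OF that] by (simp add: complex_norm_square [symmetric])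
  ultimately show ?thesis
    by (metis mult_left_cancel mult_zero_left zero_neq_one)
qed

lemma dual_pow: "\<chi> (a [^] (n::nat)) = \<chi> a ^ n"
  if "\<chi> \<in> carrier (dual_group G)" "a \<in> carrier G"
  using that by (induction n) (simp_all add: dual_one dual_mult)

lemma finite_dual_group:
  assumes "finite (carrier G)"
  shows "finite (carrier (dual_group G))"
proof -
  have "order G > 0"
    using assms by (simp add: order_gt_0_iff_finite)
  then have "finite {w::complex. w ^ order G = 1}"
    by (intro finite_roots_unity) simp
  then have "finite (carrier G \<rightarrow>\<^sub>E {w::complex. w ^ order G = 1})"
    using assms by (intro finite_PiE) auto
  moreover have "carrier (dual_group G) \<subseteq> (carrier G \<rightarrow>\<^sub>E {w::complex. w ^ order G = 1})"
  proof
    fix \<chi> assume \<chi>: "\<chi> \<in> carrier (dual_group G)"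
    then have "\<chi> a ^ order G = 1" if "a \<in> carrier G" for a
      using that dual_pow[OF \<chi> that, of "order G"] by (simp add: pow_order_eq_1 dual_one)
    then show "\<chi> \<in> carrier G \<rightarrow>\<^sub>E {w::complex. w ^ order G = 1}"
      using \<chi> by (auto simp: dual_group_def PiE_def)
  qed
  ultimately show ?thesis
    by (rule rev_finite_subset)
qed

lemma comm_group_dual_group: "comm_group (dual_group G)"
proof (rule comm_groupI)
  fix \<chi> assume \<chi>: "\<chi> \<in> carrier (dual_group G)"
  let ?\<eta> = "\<lambda>a\<in>carrier G. cnj (\<chi> a)"
  have "\<chi> a \<otimes>\<^bsub>circle_group\<^esub> cnj (\<chi> a) = 1" if "a \<in> carrier G" for a
    using dual_norm[OF \<chi> that] by (simp add: complex_norm_square [symmetric] circle_group_def)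
  then have "?\<eta> \<in> carrier (dual_group G)" "?\<eta> \<otimes>\<^bsub>dual_group G\<^esub> \<chi> = \<one>\<^bsub>dual_group G\<^esub>"
    using \<chi> by (auto simp: dual_group_def hom_def circle_group_def fun_eq_iff mult.commute)
  then show "\<exists>\<eta>\<in>carrier (dual_group G). \<eta> \<otimes>\<^bsub>dual_group G\<^esub> \<chi> = \<one>\<^bsub>dual_group G\<^esub>"
    by blast
qed (auto simp: dual_group_def hom_def circle_group_def fun_eq_iff norm_mult extensional_def Pi_iff)

end


section \<open>The quantum Latin square and its correlation\<close>

definition qls_vec ::
    "('a, 'm) monoid_scheme \<Rightarrow> (('a \<Rightarrow> complex) \<Rightarrow> ('a \<Rightarrow> complex)) \<Rightarrow>
     'a \<Rightarrow> 'a \<Rightarrow> ('a \<Rightarrow> complex) \<Rightarrow> complex" where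
  "qls_vec G \<pi> a b =
     (\<lambda>\<chi>. complex_of_real (1 / sqrt (real (order G))) *
       entrywise_prod
         (mat_vec (carrier (dual_group G)) (perm_mat \<pi>)
            (mat_vec (carrier G) char_table (std_basis a)))
         (cnj_vec (mat_vec (carrier G) char_table (std_basis b))) \<chi>)"

definition qperm_mat ::
    "('a, 'm) monoid_scheme \<Rightarrow> (('a \<Rightarrow> complex) \<Rightarrow> ('a \<Rightarrow> complex)) \<Rightarrow>
     'a \<Rightarrow> 'a \<Rightarrow> ('a \<Rightarrow> complex) \<Rightarrow> ('a \<Rightarrow> complex) \<Rightarrow> complex" where
  "qperm_mat G \<pi> a b = outer_self (qls_vec G \<pi> a b)"

text \<open>
  For \<open>P\<close> a \<open>K \<times> K\<close> array whose entries are \<open>I \<times> I\<close> matrices.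
\<close>

definition entries_commute :: "'k set \<Rightarrow> 'i set \<Rightarrow> ('k \<Rightarrow> 'k \<Rightarrow> 'i \<Rightarrow> 'i \<Rightarrow> complex) \<Rightarrow> bool" where
  "entries_commute K I P \<longleftrightarrow>
     (\<forall>a\<in>K. \<forall>b\<in>K. \<forall>c\<in>K. \<forall>d\<in>K.
        eq_mat I I (mat_mult I (P a b) (P c d)) (mat_mult I (P c d) (P a b)))"

text \<open>\<open>qcorr G \<pi> a b c d\<close> is the value of the correlation at \<open>(a,b|c,d)\<close>.\<close>

definition qcorr ::
    "('a, 'm) monoid_scheme \<Rightarrow> (('a \<Rightarrow> complex) \<Rightarrow> ('a \<Rightarrow> complex)) \<Rightarrow>
     'a \<Rightarrow> 'a \<Rightarrow> 'a \<Rightarrow> 'a \<Rightarrow> real" where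
  "qcorr G \<pi> a b c d =
     1 / real (order G) *
     (cmod (inner_prod (carrier (dual_group G)) (qls_vec G \<pi> c a) (qls_vec G \<pi> d b)))\<^sup>2"

text \<open>That the description determines a unique value is \<open>char_mat_eq\<close> below.\<close>

definition char_mat ::
    "('a, 'm) monoid_scheme \<Rightarrow> (('a \<Rightarrow> complex) \<Rightarrow> ('a \<Rightarrow> complex)) \<Rightarrow> 'a \<Rightarrow> 'a \<Rightarrow> real" where
  "char_mat G \<pi> a b =
     (THE r. \<forall>w\<in>carrier G. \<forall>x\<in>carrier G. \<forall>y\<in>carrier G. \<forall>z\<in>carrier G.
        inv\<^bsub>G\<^esub> w \<otimes>\<^bsub>G\<^esub> x = a \<longrightarrow> inv\<^bsub>G\<^esub> y \<otimes>\<^bsub>G\<^esub> z = b \<longrightarrow> r = real (order G) * qcorr G \<pi> w x y z)"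

context comm_group
begin

lemma qls_vec_eq:
  assumes "finite (carrier G)"
    and "bij_betw \<pi> (carrier (dual_group G)) (carrier (dual_group G))"
    and "a \<in> carrier G" "b \<in> carrier G" "\<chi> \<in> carrier (dual_group G)"
  shows "qls_vec G \<pi> a b \<chi> =
    complex_of_real (1 / sqrt (real (order G))) *
      (inv_into (carrier (dual_group G)) \<pi> \<chi> a * cnj (\<chi> b))"
  using assms
  by (simp add: qls_vec_def entrywise_prod_def cnj_vec_def mat_vec_std_basis
      mat_vec_perm_mat finite_dual_group char_table_def)

lemma inner_prod_qls_vec:
  assumes "finite (carrier G)"
    and \<pi>: "bij_betw \<pi> (carrier (dual_group G)) (carrier (dual_group G))"
    and "a \<in> carrier G" "b \<in> carrier G" "c \<in> carrier G" "d \<in> carrier G"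
  shows "inner_prod (carrier (dual_group G)) (qls_vec G \<pi> c a) (qls_vec G \<pi> d b) =
    complex_of_real (1 / real (order G)) *
      (\<Sum>\<chi>\<in>carrier (dual_group G).
        inv_into (carrier (dual_group G)) \<pi> \<chi> (inv c \<otimes> d) * cnj (\<chi> (inv a \<otimes> b)))"
proof -
  have s: "complex_of_real (1 / sqrt (real (order G))) * complex_of_real (1 / sqrt (real (order G)))
      = complex_of_real (1 / real (order G))"
    by (simp flip: of_real_mult)
  have "cnj (qls_vec G \<pi> c a \<chi>) * qls_vec G \<pi> d b \<chi> =
      complex_of_real (1 / real (order G)) *
        (inv_into (carrier (dual_group G)) \<pi> \<chi> (inv c \<otimes> d) * cnj (\<chi> (inv a \<otimes> b)))"
    if \<chi>: "\<chi> \<in> carrier (dual_group G)" for \<chi>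
  proof -
    have i: "inv_into (carrier (dual_group G)) \<pi> \<chi> \<in> carrier (dual_group G)"
      using \<pi> \<chi> by (metis bij_betw_def inv_into_into)
    show ?thesis
      using assms \<chi> i
      by (simp add: qls_vec_eq dual_mult dual_inv s [symmetric] del: of_real_divide)
  qed
  then show ?thesis
    unfolding inner_prod_def sum_distrib_left by (intro sum.cong) auto
qed

lemma char_mat_eq:
  assumes "finite (carrier G)"
    and "bij_betw \<pi> (carrier (dual_group G)) (carrier (dual_group G))"
    and wxyz: "w \<in> carrier G" "x \<in> carrier G" "y \<in> carrier G" "z \<in> carrier G"
  shows "char_mat G \<pi> (inv w \<otimes> x) (inv y \<otimes> z) = real (order G) * qcorr G \<pi> w x y z"
  unfolding char_mat_def
proof (rule the_equality)
  show "\<forall>w'\<in>carrier G. \<forall>x'\<in>carrier G. \<forall>y'\<in>carrier G. \<forall>z'\<in>carrier G.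
      inv w' \<otimes> x' = inv w \<otimes> x \<longrightarrow> inv y' \<otimes> z' = inv y \<otimes> z \<longrightarrow>
      real (order G) * qcorr G \<pi> w x y z = real (order G) * qcorr G \<pi> w' x' y' z'"
    using assms by (simp add: qcorr_def inner_prod_qls_vec)
qed (use wxyz in blast)

end

end

theory Submission
  imports Defs
begin

text \<open>
  The inner products of the vectors \<open>\<psi>\<close> are the numbers
  \<open>M(a, b) = |\<Gamma>|\<^bsup>-1\<^esup> \<Sum>\<^sub>x x(b) cnj (\<pi>(x)(a))\<close>, and \<open>D\<^sup>\<pi>(a, b) = |M(a, b)|\<^sup>2\<close>.  Two rank-one projections onto
  unit vectors \<open>u\<close> and \<open>v\<close> commute iff \<open>|\<langle>u, v\<rangle>|\<close> is \<open>0\<close> or \<open>1\<close>, so (1) says that \<open>D\<^sup>\<pi>\<close> has entries in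
  \<open>{0, 1}\<close>.  By Parseval \<open>D\<^sup>\<pi>\<close> is doubly stochastic, which makes this equivalent to (3).  An entry
  \<open>1\<close> at \<open>(a, \<sigma> a)\<close> is the equality case of the triangle inequality for a sum of unimodular numbers, so
  \<open>\<pi>(x)(a) = z(a) x(\<sigma> a)\<close> with \<open>z = \<pi>(1)\<close>; since characters separate points, \<open>\<sigma>\<close> is an
  automorphism.  Conversely, for such a \<open>\<pi>\<close> the orthogonality relations evaluate \<open>M\<close>.
\<close>

section \<open>Extension of characters\<close>

context comm_group
begin

text \<open>In a finite group the inverse of \<open>a\<close> is the power of \<open>a\<close> with
  exponent \<open>order G - 1\<close>, so closure under products already yields closure under
  inverses.\<close>

lemma subgroup_of_finite:
  assumes "finite (carrier G)" "H \<subseteq> carrier G" "\<one> \<in> H"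
    and closed: "\<And>a b. \<lbrakk>a \<in> H; b \<in> H\<rbrakk> \<Longrightarrow> a \<otimes> b \<in> H"
  shows "subgroup H G"
proof (rule subgroupI)
  fix a assume a: "a \<in> H"
  have pow: "a [^] (k::nat) \<in> H" for k
    by (induction k) (use a assms in auto)
  have aG: "a \<in> carrier G"
    using a assms by blast
  \<comment> \<open>Positivity makes the truncated subtraction in \<open>order G - 1\<close>
    exact.\<close>
  have "0 < order G"
    using assms by (simp add: order_gt_0_iff_finite)
  then have "a [^] (order G - 1) \<otimes> a = a [^] order G"
    using nat_pow_Suc[of a "order G - 1"] by simp
  then have "a [^] (order G - 1) = inv a"
    using aG by (intro inv_equality [symmetric]) (auto simp: pow_order_eq_1)
  then show "inv a \<in> H"
    using pow[of "order G - 1"] by simp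
qed (use assms in auto)

text \<open>The value at \<open>h \<otimes> x [^] k\<close> has to be
  \<open>\<chi> h * w ^ k\<close>. The powers of \<open>x\<close> lying in \<open>H\<close> are
  those with exponent divisible by \<open>m\<close>, so the condition on \<open>w ^ m\<close> is
  exactly what makes this value independent of the representation.\<close>

lemma hom_circle_group_extend:
  assumes fin: "finite (carrier G)" and H: "subgroup H G"
    and \<chi>: "\<chi> \<in> hom (G\<lparr>carrier := H\<rparr>) circle_group"
    and x: "x \<in> carrier G" and w: "cmod w = 1"
    and m: "\<And>k::nat. x [^] k \<in> H \<longleftrightarrow> m dvd k" and wm: "w ^ m = \<chi> (x [^] m)"
  obtains H' \<chi>' where "subgroup H' G" "H \<subseteq> H'" "x \<in> H'"
    "\<chi>' \<in> hom (G\<lparr>carrier := H'\<rparr>) circle_group" "\<chi>' x = w" "\<And>h. h \<in> H \<Longrightarrow> \<chi>' h = \<chi> h"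
proof -
  interpret H: subgroup H G by fact
  have mult: "\<chi> (a \<otimes> b) = \<chi> a * \<chi> b" and norm: "cmod (\<chi> a) = 1"
    if "a \<in> H" "b \<in> H" for a b
    using \<chi> that by (auto simp: hom_def circle_group_def)
  have one: "\<chi> \<one> = 1"
    using mult[of \<one> \<one>] norm[of \<one> \<one>] by auto
  have xm: "x [^] m \<in> H"
    using m by simp
  have pow_mem: "x [^] (m * q) \<in> H" for q :: nat
    using m by simp
  have pow: "\<chi> (x [^] (m * q)) = w ^ (m * q)" for q :: nat
  proof (induction q)
    case (Suc q)
    have "x [^] (m * Suc q) = x [^] m \<otimes> x [^] (m * q)"
      using x by (simp add: nat_pow_mult)
    then show ?case
      using Suc xm pow_mem by (simp add: mult wm power_add)
  qed (simp add: one)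
  \<comment> \<open>Two representations of one element differ by \<open>x [^] (l - k)\<close>, which
    therefore lies in \<open>H\<close>; then \<open>m\<close> divides \<open>l - k\<close> and
    \<open>pow\<close> gives the value of \<open>\<chi>\<close> there.\<close>
  have le: "\<chi> h * w ^ k = \<chi> h' * w ^ l"
    if "h \<in> H" "h' \<in> H" "h \<otimes> x [^] k = h' \<otimes> x [^] l" "k \<le> l" for h h' and k l :: nat
  proof -
    have "x [^] l = x [^] (l - k) \<otimes> x [^] k"
      using x that by (simp add: nat_pow_mult)
    then have "h \<otimes> x [^] k = (h' \<otimes> x [^] (l - k)) \<otimes> x [^] k"
      using x that by (simp add: m_assoc)
    then have h: "h = h' \<otimes> x [^] (l - k)"
      using x that by (metis H.mem_carrier m_closed nat_pow_closed r_cancel)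
    then have "x [^] (l - k) = inv h' \<otimes> h"
      using x that by (simp add: m_assoc [symmetric])
    then have "x [^] (l - k) \<in> H"
      using that by simp
    then obtain q where q: "l - k = m * q"
      using m by auto
    have "\<chi> h = \<chi> h' * w ^ (l - k)"
      unfolding h using that pow_mem[of q] pow[of q] by (simp add: mult q)
    then show ?thesis
      using \<open>k \<le> l\<close> by (simp add: power_add [symmetric])
  qed
  have wd: "\<chi> h * w ^ k = \<chi> h' * w ^ l"
    if "h \<in> H" "h' \<in> H" "h \<otimes> x [^] k = h' \<otimes> x [^] l" for h h' and k l :: nat
    using that le[of h h' k l] le[of h' h l k] by (metis nat_le_linear)
  \<comment> \<open>Natural exponents suffice: closure under inverses comes from
    \<open>subgroup_of_finite\<close>.\<close>
  define H' where "H' = {h \<otimes> x [^] (k::nat) | h k. h \<in> H}"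
  define \<chi>' where "\<chi>' g = (SOME y. \<exists>h\<in>H. \<exists>k::nat. g = h \<otimes> x [^] k \<and> y = \<chi> h * w ^ k)" for g
  have \<chi>': "\<chi>' (h \<otimes> x [^] k) = \<chi> h * w ^ k" if "h \<in> H" for h and k :: nat
    unfolding \<chi>'_def
  proof (rule some_equality)
    show "\<exists>h'\<in>H. \<exists>l::nat. h \<otimes> x [^] k = h' \<otimes> x [^] l \<and> \<chi> h * w ^ k = \<chi> h' * w ^ l"
      using that by blast
    show "y = \<chi> h * w ^ k"
      if "\<exists>h'\<in>H. \<exists>l::nat. h \<otimes> x [^] k = h' \<otimes> x [^] l \<and> y = \<chi> h' * w ^ l" for y
      using that wd[OF \<open>h \<in> H\<close>] by metis
  qed
  have H'I: "h \<otimes> x [^] k \<in> H'" if "h \<in> H" for h and k :: nat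
    using that by (auto simp: H'_def)
  have eq: "h \<otimes> x [^] k \<otimes> (h' \<otimes> x [^] l) = (h \<otimes> h') \<otimes> x [^] (k + l)"
    if "h \<in> H" "h' \<in> H" for h h' and k l :: nat
    using that x by (simp add: nat_pow_mult [symmetric] m_ac)
  show thesis
  proof
    show "H \<subseteq> H'"
      using H'I[of _ 0] by auto
    show "x \<in> H'"
      using H'I[of \<one> 1] x by simp
    show "subgroup H' G"
    proof (rule subgroup_of_finite)
      show "H' \<subseteq> carrier G"
        using x by (auto simp: H'_def)
      show "\<one> \<in> H'"
        using H'I[of \<one> 0] by simp
      show "a \<otimes> b \<in> H'" if ab: "a \<in> H'" "b \<in> H'" for a b
      proof -
        obtain h k h' l where "h \<in> H" "h' \<in> H" "a = h \<otimes> x [^] (k::nat)" "b = h' \<otimes> x [^] (l::nat)"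
          using ab by (auto simp: H'_def)
        then show ?thesis
          using H'I[of "h \<otimes> h'" "k + l"] by (simp add: eq)
      qed
    qed fact
    show "\<chi>' x = w"
      using \<chi>'[of \<one> 1] x by (simp add: one)
    show "\<chi>' h = \<chi> h" if "h \<in> H" for h
      using \<chi>'[of h 0] that by simp
    show "\<chi>' \<in> hom (G\<lparr>carrier := H'\<rparr>) circle_group"
    proof (rule homI)
      fix a assume "a \<in> carrier (G\<lparr>carrier := H'\<rparr>)"
      then obtain h k where a: "h \<in> H" "a = h \<otimes> x [^] (k::nat)"
        by (auto simp: H'_def)
      then show "\<chi>' a \<in> carrier circle_group"
        using norm w by (simp add: \<chi>' circle_group_def norm_mult norm_power)
      fix b assume "b \<in> carrier (G\<lparr>carrier := H'\<rparr>)"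
      then obtain h' l where b: "h' \<in> H" "b = h' \<otimes> x [^] (l::nat)"
        by (auto simp: H'_def)
      show "\<chi>' (a \<otimes>\<^bsub>G\<lparr>carrier := H'\<rparr>\<^esub> b) = \<chi>' a \<otimes>\<^bsub>circle_group\<^esub> \<chi>' b"
        using a b by (simp add: eq \<chi>' mult power_add circle_group_def)
    qed
  qed
qed

text \<open>Take \<open>m\<close> to be the least positive exponent with a power in
  \<open>H\<close>; by division with remainder every other such exponent is a multiple of
  it.\<close>

lemma pow_mem_subgroup_iff_dvd:
  assumes "finite (carrier G)" "subgroup H G" "x \<in> carrier G"
  obtains m :: nat where "0 < m" "\<And>k::nat. x [^] k \<in> H \<longleftrightarrow> m dvd k"
proof -
  interpret H: subgroup H G by fact
  have ex: "\<exists>m>0. x [^] (m::nat) \<in> H"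
    using assms by (intro exI[of _ "order G"])
      (simp add: pow_order_eq_1 order_gt_0_iff_finite)
  define m where "m = (LEAST m. 0 < m \<and> x [^] (m::nat) \<in> H)"
  have m: "0 < m" "x [^] m \<in> H"
    unfolding m_def using LeastI_ex[OF ex] by auto
  have min: "r = 0" if "x [^] r \<in> H" "r < m" for r :: nat
    using not_less_Least[of r "\<lambda>m. 0 < m \<and> x [^] (m::nat) \<in> H"] that by (auto simp: m_def)
  have mq: "x [^] (m * q) \<in> H" for q :: nat
    using assms m by (induction q) (auto simp: nat_pow_mult [symmetric])
  have "m dvd k" if k: "x [^] k \<in> H" for k :: nat
  proof -
    have "x [^] k = x [^] (m * (k div m)) \<otimes> x [^] (k mod m)"
      using assms by (simp add: nat_pow_mult)
    then have "x [^] (k mod m) = inv (x [^] (m * (k div m))) \<otimes> x [^] k"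
      using assms by (simp add: m_assoc [symmetric])
    then have "x [^] (k mod m) \<in> H"
      using k mq by simp
    then have "k mod m = 0"
      by (rule min) (use m in simp)
    then show ?thesis
      by (rule mod_0_imp_dvd)
  qed
  moreover have "x [^] k \<in> H" if "m dvd k" for k :: nat
    using that mq by auto
  ultimately show thesis
    using that[of m] m by blast
qed

text \<open>Adjoin elements one at a time, by induction on the number of elements outside
  \<open>H\<close>. Each step needs an \<open>m\<close>-th root of a number of modulus one, and the
  circle contains such roots.\<close>

lemma hom_circle_group_extend_carrier:
  assumes fin: "finite (carrier G)" and "subgroup H G"
    and "\<chi> \<in> hom (G\<lparr>carrier := H\<rparr>) circle_group"
  obtains \<eta> where "\<eta> \<in> carrier (dual_group G)" "\<And>h. h \<in> H \<Longrightarrow> \<eta> h = \<chi> h"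
  using assms(2,3)
proof (induction "card (carrier G - H)" arbitrary: H \<chi> thesis rule: less_induct)
  case less
  interpret H: subgroup H G by fact
  show ?case
  proof (cases "H = carrier G")
    case True
    \<comment> \<open>The restriction makes the homomorphism extensional, as membership in
      \<open>dual_group G\<close> demands.\<close>
    then show ?thesis
      using less.prems
      by (intro less.prems(1)[of "restrict \<chi> (carrier G)"])
        (auto simp: dual_group_def hom_def)
  next
    case False
    then obtain x where x: "x \<in> carrier G" "x \<notin> H"
      using H.subset by blast
    obtain m :: nat where m: "0 < m" "\<And>k::nat. x [^] k \<in> H \<longleftrightarrow> m dvd k"
      using pow_mem_subgroup_iff_dvd[OF fin less.prems(2) x(1)] by blast
    have "cmod (\<chi> (x [^] m)) = 1"
      using less.prems(3) m by (auto simp: hom_def circle_group_def)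
    then obtain t where t: "\<chi> (x [^] m) = cis t"
      using rcis_cmod_Arg[of "\<chi> (x [^] m)"] by (metis mult_1 of_real_1 rcis_def)
    \<comment> \<open>The required root is obtained by dividing the argument by
      \<open>m\<close>.\<close>
    have "cis (t / real m) ^ m = \<chi> (x [^] m)"
      using m by (simp add: DeMoivre t)
    then obtain H' \<chi>' where *: "subgroup H' G" "H \<subseteq> H'" "x \<in> H'"
        "\<chi>' \<in> hom (G\<lparr>carrier := H'\<rparr>) circle_group" "\<And>h. h \<in> H \<Longrightarrow> \<chi>' h = \<chi> h"
      using hom_circle_group_extend[OF fin less.prems(2,3) x(1) _ m(2), of "cis (t / real m)"]
      by (metis norm_cis)
    have "card (carrier G - H') < card (carrier G - H)"
      using * x fin by (intro psubset_card_mono) auto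
    then obtain \<eta> where "\<eta> \<in> carrier (dual_group G)" "\<And>h. h \<in> H' \<Longrightarrow> \<eta> h = \<chi>' h"
      using less.hyps[of H' \<chi>'] * by blast
    moreover from this have "\<eta> h = \<chi> h" if "h \<in> H" for h
      using *(2,5) that by (metis subsetD)
    ultimately show ?thesis
      using less.prems(1) by blast
  qed
qed

text \<open>Extend the trivial character of the trivial subgroup first to \<open>a\<close>, with a
  root of unity other than 1 as its value there, and then to the whole group.\<close>

lemma dual_separates_one:
  assumes fin: "finite (carrier G)" and a: "a \<in> carrier G" "a \<noteq> \<one>"
  obtains \<chi> where "\<chi> \<in> carrier (dual_group G)" "\<chi> a \<noteq> 1"
proof -
  have ord: "1 < ord a"
    using a fin ord_ge_1[of a] ord_eq_1[of a] by linarith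
  \<comment> \<open>There are \<open>ord a\<close> roots of unity of order dividing
    \<open>ord a\<close>, which is more than one.\<close>
  then have "card {w::complex. w ^ ord a = 1} \<noteq> card {1::complex}"
    by (simp add: card_roots_unity_eq)
  then have "{w::complex. w ^ ord a = 1} \<noteq> {1}"
    by metis
  moreover have "1 \<in> {w::complex. w ^ ord a = 1}"
    by simp
  ultimately obtain w :: complex where w: "w ^ ord a = 1" "w \<noteq> 1"
    by blast
  have "cmod w = 1"
    using ord power_eq_1_iff[OF w(1)] by simp
  moreover have "a [^] k \<in> {\<one>} \<longleftrightarrow> ord a dvd k" for k :: nat
    using a by (simp add: pow_eq_id)
  moreover have "(\<lambda>_. 1) \<in> hom (G\<lparr>carrier := {\<one>}\<rparr>) circle_group"
    by (simp add: hom_def circle_group_def)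
  ultimately obtain H' \<chi>' where *: "subgroup H' G" "a \<in> H'"
      "\<chi>' \<in> hom (G\<lparr>carrier := H'\<rparr>) circle_group" "\<chi>' a = w"
    using hom_circle_group_extend[OF fin triv_subgroup _ a(1) _ _ w(1)] by metis
  obtain \<eta> where "\<eta> \<in> carrier (dual_group G)" "\<And>h. h \<in> H' \<Longrightarrow> \<eta> h = \<chi>' h"
    using hom_circle_group_extend_carrier[OF fin *(1,3)] by blast
  then show thesis
    using that[of \<eta>] * w by simp
qed

end

section \<open>Orthogonality of characters\<close>

context comm_group
begin

lemma dual_eqI:
  assumes "\<chi> \<in> carrier (dual_group G)" "\<eta> \<in> carrier (dual_group G)"
    and "\<And>a. a \<in> carrier G \<Longrightarrow> \<chi> a = \<eta> a"
  shows "\<chi> = \<eta>"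
  using assms by (auto simp: dual_group_def intro: extensionalityI)

lemma dual_mult_apply:
  "(\<chi> \<otimes>\<^bsub>dual_group G\<^esub> \<eta>) a = \<chi> a * \<eta> a" if "a \<in> carrier G"
  using that by (simp add: dual_group_def)

lemma dual_one_apply: "\<one>\<^bsub>dual_group G\<^esub> a = 1" if "a \<in> carrier G"
  using that by (simp add: dual_group_def)

lemma dual_mult_cnj: "\<chi> a * cnj (\<chi> a) = 1"
  if "\<chi> \<in> carrier (dual_group G)" "a \<in> carrier G"
  using dual_norm[OF that] by (simp add: complex_norm_square [symmetric])

lemma dual_separates:
  assumes "finite (carrier G)" "a \<in> carrier G" "b \<in> carrier G"
    and eq: "\<And>\<chi>. \<chi> \<in> carrier (dual_group G) \<Longrightarrow> \<chi> a = \<chi> b"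
  shows "a = b"
proof (rule ccontr)
  assume "a \<noteq> b"
  then have "a \<otimes> inv b \<noteq> \<one>"
    using assms by (metis inv_equality inv_inv inv_closed)
  then obtain \<chi> where \<chi>: "\<chi> \<in> carrier (dual_group G)" "\<chi> (a \<otimes> inv b) \<noteq> 1"
    using dual_separates_one assms by (metis inv_closed m_closed)
  then show False
    using eq[OF \<chi>(1)] assms by (simp add: dual_mult dual_inv dual_mult_cnj)
qed

lemma sum_dual_translate:
  assumes "\<eta> \<in> carrier (dual_group G)"
  shows "(\<Sum>\<chi>\<in>carrier (dual_group G). f (\<eta> \<otimes>\<^bsub>dual_group G\<^esub> \<chi>)) = sum f (carrier (dual_group G))"
proof -
  interpret D: comm_group "dual_group G"
    by (rule comm_group_dual_group)
  have "bij_betw (\<lambda>\<chi>. \<eta> \<otimes>\<^bsub>dual_group G\<^esub> \<chi>) (carrier (dual_group G)) (carrier (dual_group G))"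
    using D.surj_const_mult[OF assms] D.inj_on_cmult[OF assms] by (simp add: bij_betw_def)
  then show ?thesis
    by (rule sum.reindex_bij_betw)
qed

lemma sum_translate:
  assumes "c \<in> carrier G"
  shows "(\<Sum>a\<in>carrier G. f (c \<otimes> a)) = sum f (carrier G)"
proof -
  have "bij_betw (\<lambda>a. c \<otimes> a) (carrier G) (carrier G)"
    using surj_const_mult[OF assms] inj_on_cmult[OF assms] by (simp add: bij_betw_def)
  then show ?thesis
    by (rule sum.reindex_bij_betw)
qed

text \<open>If the characters differ at \<open>c\<close>, translating the summation variable by
  \<open>c\<close> multiplies the sum by a factor other than 1, so the sum vanishes.\<close>

lemma dual_orthogonal:
  assumes fin: "finite (carrier G)"
    and \<chi>: "\<chi> \<in> carrier (dual_group G)" and \<eta>: "\<eta> \<in> carrier (dual_group G)"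
  shows "(\<Sum>a\<in>carrier G. \<chi> a * cnj (\<eta> a)) = (if \<chi> = \<eta> then of_nat (order G) else 0)"
proof (cases "\<chi> = \<eta>")
  case True
  then show ?thesis
    using \<eta> by (simp add: dual_mult_cnj order_def)
next
  case False
  then obtain c where c: "c \<in> carrier G" "\<chi> c \<noteq> \<eta> c"
    using dual_eqI[OF \<chi> \<eta>] by blast
  let ?S = "\<Sum>a\<in>carrier G. \<chi> a * cnj (\<eta> a)"
  have "?S = (\<Sum>a\<in>carrier G. \<chi> (c \<otimes> a) * cnj (\<eta> (c \<otimes> a)))"
    by (rule sum_translate [OF c(1), symmetric])
  also have "\<dots> = (\<chi> c * cnj (\<eta> c)) * ?S"
    using c \<chi> \<eta> by (simp add: sum_distrib_left dual_mult mult_ac)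
  finally have "\<chi> c * cnj (\<eta> c) = 1 \<or> ?S = 0"
    by auto
  \<comment> \<open>Since \<open>\<eta> c\<close> has modulus one, a factor 1 would force
    \<open>\<chi> c = \<eta> c\<close>.\<close>
  moreover have "\<chi> c * cnj (\<eta> c) \<noteq> 1"
  proof
    assume "\<chi> c * cnj (\<eta> c) = 1"
    then have "\<chi> c * (\<eta> c * cnj (\<eta> c)) = \<eta> c"
      by (metis mult.assoc mult.commute mult.right_neutral)
    then show False
      using c \<eta> by (simp add: dual_mult_cnj)
  qed
  ultimately show ?thesis
    using False by simp
qed

text \<open>The same translation argument, now in the dual group, with a character that separates
  \<open>a\<close> from the identity.\<close>

lemma sum_dual_apply_neq_one:
  assumes "finite (carrier G)" "a \<in> carrier G" "a \<noteq> \<one>"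
  shows "(\<Sum>\<chi>\<in>carrier (dual_group G). \<chi> a) = 0"
proof -
  obtain \<eta> where \<eta>: "\<eta> \<in> carrier (dual_group G)" "\<eta> a \<noteq> 1"
    using dual_separates_one assms by blast
  let ?S = "\<Sum>\<chi>\<in>carrier (dual_group G). \<chi> a"
  have "?S = (\<Sum>\<chi>\<in>carrier (dual_group G). (\<eta> \<otimes>\<^bsub>dual_group G\<^esub> \<chi>) a)"
    by (rule sum_dual_translate [OF \<eta>(1), of "\<lambda>\<chi>. \<chi> a", symmetric])
  also have "\<dots> = \<eta> a * ?S"
    using assms by (simp add: dual_mult_apply sum_distrib_left)
  finally show ?thesis
    using \<eta> by auto
qed

text \<open>Summing all values of all characters by rows and by columns.\<close>

lemma card_dual_group:
  assumes "finite (carrier G)"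
  shows "card (carrier (dual_group G)) = order G"
proof -
  interpret D: comm_group "dual_group G"
    by (rule comm_group_dual_group)
  let ?\<epsilon> = "\<one>\<^bsub>dual_group G\<^esub>"
  have "(of_nat (card (carrier (dual_group G))) :: complex) =
      (\<Sum>a\<in>carrier G. if a = \<one> then of_nat (card (carrier (dual_group G))) else 0)"
    using assms by simp
  also have "\<dots> = (\<Sum>a\<in>carrier G. \<Sum>\<chi>\<in>carrier (dual_group G). \<chi> a)"
    using assms by (intro sum.cong) (auto simp: sum_dual_apply_neq_one dual_one)
  \<comment> \<open>The trivial character is inserted to bring the inner sum into the form of
    \<open>dual_orthogonal\<close>.\<close>
  also have "\<dots> = (\<Sum>\<chi>\<in>carrier (dual_group G). \<Sum>a\<in>carrier G. \<chi> a * cnj (?\<epsilon> a))"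
    by (subst sum.swap) (simp add: dual_one_apply)
  also have "\<dots> = of_nat (order G)"
    using assms by (simp add: dual_orthogonal finite_dual_group)
  finally show ?thesis
    by simp
qed

lemma dual_orthogonal_columns:
  assumes "finite (carrier G)" "a \<in> carrier G" "b \<in> carrier G"
  shows "(\<Sum>\<chi>\<in>carrier (dual_group G). \<chi> a * cnj (\<chi> b)) = (if a = b then of_nat (order G) else 0)"
proof -
  have "(\<Sum>\<chi>\<in>carrier (dual_group G). \<chi> a * cnj (\<chi> b)) =
      (\<Sum>\<chi>\<in>carrier (dual_group G). \<chi> (a \<otimes> inv b))"
    using assms by (intro sum.cong) (auto simp: dual_mult dual_inv)
  moreover have "a \<otimes> inv b = \<one> \<longleftrightarrow> a = b"
    using assms by (metis inv_equality inv_inv inv_closed r_inv)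
  ultimately show ?thesis
    using assms by (simp add: sum_dual_apply_neq_one card_dual_group dual_one)
qed

text \<open>Expanding the squares and summing over \<open>a\<close> first leaves only the diagonal
  terms. The freedom in \<open>f\<close> and \<open>\<rho>\<close> serves to cover both rows
  (\<open>\<rho>\<close> the identity) and columns (\<open>\<rho>\<close> equal to
  \<open>\<pi>\<close>) of the characteristic matrix.\<close>

lemma dual_parseval:
  assumes fin: "finite (carrier G)" and f: "\<And>\<chi>. \<chi> \<in> carrier (dual_group G) \<Longrightarrow> cmod (f \<chi>) = 1"
    and \<rho>: "bij_betw \<rho> (carrier (dual_group G)) (carrier (dual_group G))"
  shows "(\<Sum>a\<in>carrier G. (cmod (\<Sum>\<chi>\<in>carrier (dual_group G). f \<chi> * \<rho> \<chi> a))\<^sup>2) = (real (order G))\<^sup>2"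
proof -
  let ?D = "carrier (dual_group G)"
  have \<rho>D: "\<rho> \<chi> \<in> ?D" if "\<chi> \<in> ?D" for \<chi>
    using \<rho> that by (auto simp: bij_betw_def)
  have eq: "\<rho> \<chi> = \<rho> \<eta> \<longleftrightarrow> \<chi> = \<eta>" if "\<chi> \<in> ?D" "\<eta> \<in> ?D" for \<chi> \<eta>
    using \<rho> that by (auto simp: bij_betw_def inj_on_def)
  have "complex_of_real (\<Sum>a\<in>carrier G. (cmod (\<Sum>\<chi>\<in>?D. f \<chi> * \<rho> \<chi> a))\<^sup>2) =
      (\<Sum>a\<in>carrier G. \<Sum>\<chi>\<in>?D. \<Sum>\<eta>\<in>?D. f \<chi> * cnj (f \<eta>) * (\<rho> \<chi> a * cnj (\<rho> \<eta> a)))"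
    by (simp add: complex_norm_square sum_product mult_ac del: of_real_power)
  also have "\<dots> = (\<Sum>\<chi>\<in>?D. \<Sum>a\<in>carrier G. \<Sum>\<eta>\<in>?D. f \<chi> * cnj (f \<eta>) * (\<rho> \<chi> a * cnj (\<rho> \<eta> a)))"
    by (rule sum.swap)
  also have "\<dots> = (\<Sum>\<chi>\<in>?D. \<Sum>\<eta>\<in>?D. \<Sum>a\<in>carrier G. f \<chi> * cnj (f \<eta>) * (\<rho> \<chi> a * cnj (\<rho> \<eta> a)))"
    by (intro sum.cong refl sum.swap)
  \<comment> \<open>Injectivity of \<open>\<rho>\<close> turns the condition
    \<open>\<rho> \<chi> = \<rho> \<eta>\<close> from orthogonality into
    \<open>\<chi> = \<eta>\<close>.\<close>
  also have "\<dots> = (\<Sum>\<chi>\<in>?D. \<Sum>\<eta>\<in>?D. if \<chi> = \<eta> then f \<chi> * cnj (f \<chi>) * of_nat (order G) else 0)"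
    using fin by (intro sum.cong refl) (simp add: sum_distrib_left [symmetric] dual_orthogonal \<rho>D eq)
  also have "\<dots> = (\<Sum>\<chi>\<in>?D. of_nat (order G))"
    using fin f by (intro sum.cong refl) (simp add: finite_dual_group complex_norm_square [symmetric])
  also have "\<dots> = complex_of_real ((real (order G))\<^sup>2)"
    using fin by (simp add: card_dual_group power2_eq_square)
  finally show ?thesis
    by (simp only: of_real_eq_iff)
qed

end

section \<open>Finite families of complex vectors\<close>

text \<open>The sum of squared distances to the mean is \<open>card I - |S|\<^sup>2 / card I\<close>, where \<open>S\<close> is the sum.\<close>

lemma cmod_sum_eq_card_imp_const:
  assumes "finite I" "\<And>i. i \<in> I \<Longrightarrow> cmod (f i) = 1" and S: "cmod (sum f I) = real (card I)"
    and i: "i \<in> I"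
  shows "f i = sum f I / of_nat (card I)"
proof -
  let ?n = "of_nat (card I) :: complex"
  define \<mu> where "\<mu> = sum f I / ?n"
  have n: "?n \<noteq> 0"
    using assms by auto
  have "complex_of_real (\<Sum>i\<in>I. (cmod (f i - \<mu>))\<^sup>2) =
      (\<Sum>i\<in>I. f i * cnj (f i) - f i * cnj \<mu> - \<mu> * cnj (f i) + \<mu> * cnj \<mu>)"
    by (simp add: complex_norm_square algebra_simps del: of_real_power)
  also have "\<dots> = (\<Sum>i\<in>I. f i * cnj (f i)) - sum f I * cnj \<mu> - \<mu> * cnj (sum f I) + ?n * (\<mu> * cnj \<mu>)"
    by (simp only: sum.distrib sum_subtractf sum_distrib_left sum_distrib_right sum_constant cnj_sum)
  also have "(\<Sum>i\<in>I. f i * cnj (f i)) = ?n"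
    using assms by (simp add: complex_norm_square [symmetric])
  also have "?n - sum f I * cnj \<mu> - \<mu> * cnj (sum f I) + ?n * (\<mu> * cnj \<mu>)
      = ?n - (sum f I * cnj (sum f I)) / ?n"
    using n by (simp add: \<mu>_def field_simps)
  \<comment> \<open>Here the maximality of the modulus of the sum enters and makes the variance
    zero.\<close>
  also have "sum f I * cnj (sum f I) = ?n * ?n"
    using complex_norm_square[of "sum f I"] S by (simp add: power2_eq_square)
  also have "?n - ?n * ?n / ?n = 0"
    using n by simp
  finally have "(\<Sum>i\<in>I. (cmod (f i - \<mu>))\<^sup>2) = 0"
    by (simp only: of_real_eq_0_iff)
  then have "f i = \<mu>"
    using sum_nonneg_0[OF assms(1), of "\<lambda>i. (cmod (f i - \<mu>))\<^sup>2" i] i by simp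
  then show ?thesis
    by (simp only: \<mu>_def)
qed

section \<open>Commutation of rank-one projections\<close>

lemma inner_prod_cnj: "cnj (inner_prod I u v) = inner_prod I v u"
  by (simp add: inner_prod_def mult_ac)

lemma mat_mult_outer_self:
  "mat_mult I (outer_self u) (outer_self v) i j = inner_prod I u v * (u i * cnj (v j))"
  by (simp add: mat_mult_def outer_self_def inner_prod_def sum_distrib_left mult_ac)

text \<open>Equality case of Cauchy-Schwarz: with \<open>c\<close> the inner product, the squared
  norm of \<open>v - c u\<close> expands to \<open>1 - 1 - 1 + 1\<close>.\<close>

lemma unit_vectors_parallel:
  assumes "finite I" "inner_prod I u u = 1" "inner_prod I v v = 1"
    and "cmod (inner_prod I u v) = 1" "i \<in> I"
  shows "v i = inner_prod I u v * u i"
proof -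
  let ?c = "inner_prod I u v"
  have c: "?c * cnj ?c = 1"
    using assms by (simp add: complex_norm_square [symmetric])
  have "complex_of_real (\<Sum>i\<in>I. (cmod (v i - ?c * u i))\<^sup>2) =
      (\<Sum>i\<in>I. cnj (v i) * v i - ?c * (cnj (v i) * u i) - cnj ?c * (cnj (u i) * v i) + ?c * cnj ?c * (cnj (u i) * u i))"
    by (simp add: complex_norm_square algebra_simps del: of_real_power)
  also have "\<dots> = inner_prod I v v - ?c * inner_prod I v u - cnj ?c * inner_prod I u v + ?c * cnj ?c * inner_prod I u u"
    unfolding inner_prod_def by (simp only: sum.distrib sum_subtractf sum_distrib_left)
  also have "\<dots> = 0"
    using assms c by (simp add: inner_prod_cnj [symmetric, of I u v] mult.commute)
  finally have "(\<Sum>i\<in>I. (cmod (v i - ?c * u i))\<^sup>2) = 0"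
    by (simp only: of_real_eq_0_iff)
  then show ?thesis
    using sum_nonneg_0[OF assms(1), of "\<lambda>i. (cmod (v i - ?c * u i))\<^sup>2" i] assms(5) by simp
qed

text \<open>With \<open>c\<close> the inner product of \<open>u\<close> and \<open>v\<close>,
  commutation forces \<open>c\<close> to equal \<open>c\<close> times its squared modulus.
  Conversely, both products vanish if \<open>c = 0\<close>, and both projections coincide if
  \<open>c\<close> has modulus one.\<close>

lemma outer_self_commute_iff:
  assumes "finite I" and u: "inner_prod I u u = 1" and v: "inner_prod I v v = 1"
  shows "eq_mat I I (mat_mult I (outer_self u) (outer_self v)) (mat_mult I (outer_self v) (outer_self u))
    \<longleftrightarrow> (cmod (inner_prod I u v))\<^sup>2 \<in> {0, 1}"
proof
  let ?c = "inner_prod I u v"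
  assume L: "eq_mat I I (mat_mult I (outer_self u) (outer_self v)) (mat_mult I (outer_self v) (outer_self u))"
  \<comment> \<open>Evaluate the sesquilinear form of both products at \<open>(u, v)\<close>.\<close>
  have "?c * (cnj (u i) * u i) * (cnj (v j) * v j) = cnj ?c * (cnj (u i) * v i) * (cnj (u j) * v j)"
    if "i \<in> I" "j \<in> I" for i j
  proof -
    have "?c * (u i * cnj (v j)) = cnj ?c * (v i * cnj (u j))"
      using L that by (simp add: eq_mat_def mat_mult_outer_self inner_prod_cnj)
    then have "cnj (u i) * v j * (?c * (u i * cnj (v j))) = cnj (u i) * v j * (cnj ?c * (v i * cnj (u j)))"
      by simp
    then show ?thesis
      by (simp add: mult_ac)
  qed
  then have "(\<Sum>i\<in>I. \<Sum>j\<in>I. ?c * (cnj (u i) * u i) * (cnj (v j) * v j)) =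
      (\<Sum>i\<in>I. \<Sum>j\<in>I. cnj ?c * (cnj (u i) * v i) * (cnj (u j) * v j))"
    by (intro sum.cong refl) auto
  then have "?c * inner_prod I u u * inner_prod I v v = cnj ?c * ?c * ?c"
    unfolding inner_prod_def by (simp only: sum_distrib_left [symmetric] sum_distrib_right [symmetric])
  then have "?c = 0 \<or> ?c * cnj ?c = 1"
    using u v by (auto simp: mult.commute)
  then show "(cmod ?c)\<^sup>2 \<in> {0, 1}"
    by (auto simp: complex_norm_square [symmetric] simp flip: of_real_power)
next
  let ?c = "inner_prod I u v"
  assume "(cmod ?c)\<^sup>2 \<in> {0, 1}"
  \<comment> \<open>This excludes the negative root of the equation for the squared modulus.\<close>
  moreover have "cmod ?c \<noteq> - 1"
    using norm_ge_zero[of ?c] by linarith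
  ultimately consider "?c = 0" | "cmod ?c = 1"
    by (auto simp: power2_eq_1_iff)
  then show "eq_mat I I (mat_mult I (outer_self u) (outer_self v)) (mat_mult I (outer_self v) (outer_self u))"
  proof cases
    case 1
    then have "inner_prod I v u = 0"
      using inner_prod_cnj[of I u v] by simp
    with 1 show ?thesis
      by (simp add: eq_mat_def mat_mult_outer_self)
  next
    case 2
    then have c: "?c * cnj ?c = 1"
      by (simp add: complex_norm_square [symmetric])
    have v_eq: "v i = ?c * u i" if "i \<in> I" for i
      using unit_vectors_parallel[OF assms 2 that] .
    have "?c * (u i * cnj (v j)) = cnj ?c * (v i * cnj (u j))" if "i \<in> I" "j \<in> I" for i j
    proof -
      have "?c * (u i * cnj (v j)) = (?c * cnj ?c) * (u i * cnj (u j))"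
        using v_eq[OF that(2)] by (metis complex_cnj_mult mult.assoc mult.left_commute)
      moreover have "cnj ?c * (v i * cnj (u j)) = (?c * cnj ?c) * (u i * cnj (u j))"
        using v_eq[OF that(1)] by (metis mult.assoc mult.left_commute)
      ultimately show ?thesis
        by metis
    qed
    then show ?thesis
      by (simp add: eq_mat_def mat_mult_outer_self inner_prod_cnj)
  qed
qed

section \<open>The characteristic matrix\<close>

text \<open>A zero-one family with sum 1 contains exactly one 1. Applied to columns this defines the
  permutation; applied to rows it gives injectivity by uniqueness and surjectivity by
  existence.\<close>

lemma zero_one_doubly_stochastic_imp_perm_mat:
  fixes A :: "'i \<Rightarrow> 'i \<Rightarrow> real"
  assumes fin: "finite I" and A: "\<And>i j. \<lbrakk>i \<in> I; j \<in> I\<rbrakk> \<Longrightarrow> A i j \<in> {0, 1}"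
    and rows: "\<And>i. i \<in> I \<Longrightarrow> (\<Sum>j\<in>I. A i j) = 1"
    and cols: "\<And>j. j \<in> I \<Longrightarrow> (\<Sum>i\<in>I. A i j) = 1"
  shows "is_perm_mat I A"
proof -
  have ex1: "\<exists>!i. i \<in> I \<and> f i = 1" if "\<And>i. i \<in> I \<Longrightarrow> f i \<in> {0, 1}" "sum f I = 1" for f :: "'i \<Rightarrow> real"
  proof -
    have "sum f I = (\<Sum>i\<in>I. if f i = 1 then 1 else 0)"
      using that by (intro sum.cong) auto
    then have "real (card {i \<in> I. f i = 1}) = 1"
      using fin that by (simp add: sum.If_cases Collect_conj_eq)
    then obtain i where "{i \<in> I. f i = 1} = {i}"
      by (auto simp: card_1_singleton_iff)
    then have "j \<in> I \<and> f j = 1 \<longleftrightarrow> j = i" for j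
      by (simp add: set_eq_iff)
    then show ?thesis
      by simp
  qed
  have col: "\<exists>!i. i \<in> I \<and> A i j = 1" if "j \<in> I" for j
    by (rule ex1[of "\<lambda>i. A i j"]) (use A cols that in auto)
  have row: "\<exists>!j. j \<in> I \<and> A i j = 1" if "i \<in> I" for i
    by (rule ex1) (use A rows that in auto)
  \<comment> \<open>By the convention of \<open>perm_mat\<close>, the image of \<open>j\<close> is
    the row of the 1 in column \<open>j\<close>.\<close>
  define \<rho> where "\<rho> j = (THE i. i \<in> I \<and> A i j = 1)" for j
  have \<rho>: "\<rho> j \<in> I \<and> A (\<rho> j) j = 1" if "j \<in> I" for j
    unfolding \<rho>_def by (rule theI' [OF col [OF that]])
  have \<rho>_eq: "\<rho> j = i" if "i \<in> I" "j \<in> I" "A i j = 1" for i j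
    using col[OF that(2)] \<rho>[OF that(2)] that by blast
  have "bij_betw \<rho> I I"
  proof (rule bij_betw_imageI)
    show "inj_on \<rho> I"
    proof (rule inj_onI)
      fix j j' assume "j \<in> I" "j' \<in> I" "\<rho> j = \<rho> j'"
      then show "j = j'"
        using \<rho>[of j] \<rho>[of j'] row[of "\<rho> j"] by auto
    qed
    have "i \<in> \<rho> ` I" if "i \<in> I" for i
      using row[OF that] \<rho>_eq[OF that] by blast
    then show "\<rho> ` I = I"
      using \<rho> by auto
  qed
  moreover have "A i j = (if i = \<rho> j then 1 else 0)" if "i \<in> I" "j \<in> I" for i j
  proof (cases "i = \<rho> j")
    case False
    then have "A i j \<noteq> 1"
      using \<rho>_eq[OF that] by blast
    then show ?thesis
      using A[OF that] False by simp
  qed (simp add: \<rho>[OF that(2)])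
  ultimately show ?thesis
    by (auto simp: is_perm_mat_def eq_mat_def perm_mat_def)
qed

section \<open>Zero-one entries of the characteristic matrix: commutation and the permutation
  property\<close>

context comm_group
begin

text \<open>Evaluate the correlation with both base points at the identity. Substituting
  \<open>\<chi> = \<pi> x\<close> removes the inverse of \<open>\<pi>\<close> that the permutation
  matrix puts into the vectors.\<close>

lemma char_mat_apply:
  assumes fin: "finite (carrier G)"
    and \<pi>: "bij_betw \<pi> (carrier (dual_group G)) (carrier (dual_group G))"
    and a: "a \<in> carrier G" and b: "b \<in> carrier G"
  shows "char_mat G \<pi> a b =
    (cmod (\<Sum>x\<in>carrier (dual_group G). x b * cnj (\<pi> x a)) / real (order G))\<^sup>2"
proof -
  let ?D = "carrier (dual_group G)"
  have "(\<Sum>x\<in>?D. x b * cnj (\<pi> x a)) = (\<Sum>x\<in>?D. inv_into ?D \<pi> (\<pi> x) b * cnj (\<pi> x a))"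
    using \<pi> by (intro sum.cong) (auto simp: bij_betw_inv_into_left)
  also have "\<dots> = (\<Sum>\<chi>\<in>?D. inv_into ?D \<pi> \<chi> b * cnj (\<chi> a))"
    by (rule sum.reindex_bij_betw [OF \<pi>, of "\<lambda>\<chi>. inv_into ?D \<pi> \<chi> b * cnj (\<chi> a)"])
  finally have "inner_prod ?D (qls_vec G \<pi> \<one> \<one>) (qls_vec G \<pi> b a) =
      complex_of_real (1 / real (order G)) * (\<Sum>x\<in>?D. x b * cnj (\<pi> x a))"
    using assms by (simp add: inner_prod_qls_vec)
  moreover have "order G > 0"
    using fin by (simp add: order_gt_0_iff_finite)
  ultimately show ?thesis
    using char_mat_eq[OF fin \<pi> one_closed a one_closed b] a b
    by (simp add: qcorr_def norm_mult norm_divide)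
qed

text \<open>The correlation lists the second indices of the two vectors first, hence the quotient of
  the second indices becomes the row index.\<close>

lemma cmod_inner_prod_qls_vec:
  assumes "finite (carrier G)"
    and "bij_betw \<pi> (carrier (dual_group G)) (carrier (dual_group G))"
    and "a \<in> carrier G" "b \<in> carrier G" "c \<in> carrier G" "d \<in> carrier G"
  shows "(cmod (inner_prod (carrier (dual_group G)) (qls_vec G \<pi> a b) (qls_vec G \<pi> c d)))\<^sup>2 =
    char_mat G \<pi> (inv b \<otimes> d) (inv a \<otimes> c)"
proof -
  have "order G > 0"
    using assms by (simp add: order_gt_0_iff_finite)
  then show ?thesis
    using char_mat_eq[OF assms(1,2,4,6,3,5)] by (simp add: qcorr_def)
qed

lemma qls_vec_unit:
  assumes "finite (carrier G)"
    and "bij_betw \<pi> (carrier (dual_group G)) (carrier (dual_group G))"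
    and "a \<in> carrier G" "b \<in> carrier G"
  shows "inner_prod (carrier (dual_group G)) (qls_vec G \<pi> a b) (qls_vec G \<pi> a b) = 1"
proof -
  have "order G > 0"
    using assms by (simp add: order_gt_0_iff_finite)
  moreover have "inv_into (carrier (dual_group G)) \<pi> \<chi> \<in> carrier (dual_group G)"
    if "\<chi> \<in> carrier (dual_group G)" for \<chi>
    using assms(2) that by (metis bij_betw_def inv_into_into)
  ultimately show ?thesis
    using assms by (simp add: inner_prod_qls_vec dual_one card_dual_group)
qed

text \<open>By \<open>outer_self_commute_iff\<close>, each commutation condition is a zero-one
  condition on one entry of the characteristic matrix, and every entry arises in this way.\<close>

lemma entries_commute_iff_char_mat:
  assumes fin: "finite (carrier G)"
    and \<pi>: "bij_betw \<pi> (carrier (dual_group G)) (carrier (dual_group G))"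
  shows "entries_commute (carrier G) (carrier (dual_group G)) (qperm_mat G \<pi>)
    \<longleftrightarrow> (\<forall>a\<in>carrier G. \<forall>b\<in>carrier G. char_mat G \<pi> a b \<in> {0, 1})"
proof -
  have "entries_commute (carrier G) (carrier (dual_group G)) (qperm_mat G \<pi>) \<longleftrightarrow>
      (\<forall>a\<in>carrier G. \<forall>b\<in>carrier G. \<forall>c\<in>carrier G. \<forall>d\<in>carrier G.
        char_mat G \<pi> (inv b \<otimes> d) (inv a \<otimes> c) \<in> {0, 1})"
    unfolding entries_commute_def qperm_mat_def
    by (intro ball_cong refl)
      (simp only: outer_self_commute_iff finite_dual_group qls_vec_unit cmod_inner_prod_qls_vec fin \<pi>)
  also have "\<dots> \<longleftrightarrow> (\<forall>a\<in>carrier G. \<forall>b\<in>carrier G. char_mat G \<pi> a b \<in> {0, 1})"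
    (is "?L \<longleftrightarrow> ?R")
  proof
    assume L: ?L
    show ?R
    proof (intro ballI)
      fix a b assume "a \<in> carrier G" "b \<in> carrier G"
      then show "char_mat G \<pi> a b \<in> {0, 1}"
        \<comment> \<open>Identity elements in the first pair of indices make the two quotients
          equal to \<open>a\<close> and \<open>b\<close>.\<close>
        using L[rule_format, of \<one> \<one> b a] by simp
    qed
  qed simp
  finally show ?thesis .
qed

lemma char_mat_doubly_stochastic:
  assumes fin: "finite (carrier G)"
    and \<pi>: "bij_betw \<pi> (carrier (dual_group G)) (carrier (dual_group G))"
    and a: "a \<in> carrier G"
  shows "(\<Sum>b\<in>carrier G. char_mat G \<pi> a b) = 1" and "(\<Sum>b\<in>carrier G. char_mat G \<pi> b a) = 1"
proof -
  let ?D = "carrier (dual_group G)"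
  have n: "order G > 0"
    using fin by (simp add: order_gt_0_iff_finite)
  have \<pi>D: "\<pi> x \<in> ?D" if "x \<in> ?D" for x
    using \<pi> that by (auto simp: bij_betw_def)
  have "(\<Sum>b\<in>carrier G. (cmod (\<Sum>x\<in>?D. x b * cnj (\<pi> x a)))\<^sup>2) = (real (order G))\<^sup>2"
    using dual_parseval[OF fin, of "\<lambda>x. cnj (\<pi> x a)" id] a \<pi>D by (simp add: dual_norm mult.commute)
  then show "(\<Sum>b\<in>carrier G. char_mat G \<pi> a b) = 1"
    using n a fin \<pi> by (simp add: char_mat_apply power_divide sum_divide_distrib [symmetric])
  \<comment> \<open>Conjugation moves the character with the varying argument into the position it
    has in \<open>dual_parseval\<close>.\<close>
  have "cmod (\<Sum>x\<in>?D. x a * cnj (\<pi> x b)) = cmod (\<Sum>x\<in>?D. cnj (x a) * \<pi> x b)" for b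
    by (subst complex_mod_cnj [symmetric]) simp
  then have "(\<Sum>b\<in>carrier G. (cmod (\<Sum>x\<in>?D. x a * cnj (\<pi> x b)))\<^sup>2) = (real (order G))\<^sup>2"
    using dual_parseval[OF fin, of "\<lambda>x. cnj (x a)" \<pi>] a \<pi> by (simp add: dual_norm)
  then show "(\<Sum>b\<in>carrier G. char_mat G \<pi> b a) = 1"
    using n a fin \<pi> by (simp add: char_mat_apply power_divide sum_divide_distrib [symmetric])
qed

lemma is_perm_mat_char_mat_iff:
  assumes fin: "finite (carrier G)"
    and \<pi>: "bij_betw \<pi> (carrier (dual_group G)) (carrier (dual_group G))"
  shows "is_perm_mat (carrier G) (char_mat G \<pi>)
    \<longleftrightarrow> (\<forall>a\<in>carrier G. \<forall>b\<in>carrier G. char_mat G \<pi> a b \<in> {0, 1})"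
proof
  assume "is_perm_mat (carrier G) (char_mat G \<pi>)"
  then show "\<forall>a\<in>carrier G. \<forall>b\<in>carrier G. char_mat G \<pi> a b \<in> {0, 1}"
    by (auto simp: is_perm_mat_def eq_mat_def perm_mat_def)
next
  assume "\<forall>a\<in>carrier G. \<forall>b\<in>carrier G. char_mat G \<pi> a b \<in> {0, 1}"
  then show "is_perm_mat (carrier G) (char_mat G \<pi>)"
    using fin char_mat_doubly_stochastic[OF fin \<pi>]
    by (intro zero_one_doubly_stochastic_imp_perm_mat) auto
qed

section \<open>Affine permutations of the dual group\<close>

lemma dual_affine_iff:
  assumes \<sigma>: "\<sigma> \<in> auto G" and z: "z \<in> carrier (dual_group G)" and x: "x \<in> carrier (dual_group G)"
    and y: "y \<in> carrier (dual_group G)"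
  shows "y = z \<otimes>\<^bsub>dual_group G\<^esub> dual_auto G \<sigma> x \<longleftrightarrow> (\<forall>a\<in>carrier G. y a = z a * x (\<sigma> a))"
proof -
  have "dual_auto G \<sigma> x a = x (\<sigma> a)" if "a \<in> carrier G" for a
    using that x by (simp add: dual_auto_def compose_def)
  then have val: "(z \<otimes>\<^bsub>dual_group G\<^esub> dual_auto G \<sigma> x) a = z a * x (\<sigma> a)" if "a \<in> carrier G" for a
    using that by (simp add: dual_mult_apply)
  have ext: "z \<otimes>\<^bsub>dual_group G\<^esub> dual_auto G \<sigma> x \<in> extensional (carrier G)"
    "y \<in> extensional (carrier G)"
    using y by (auto simp: dual_group_def)
  show ?thesis
  proof
    assume "\<forall>a\<in>carrier G. y a = z a * x (\<sigma> a)"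
    then show "y = z \<otimes>\<^bsub>dual_group G\<^esub> dual_auto G \<sigma> x"
      by (intro extensionalityI[OF ext(2,1)]) (simp add: val)
  qed (simp add: val)
qed

text \<open>Column orthogonality leaves only the entries at \<open>(a, \<sigma> a)\<close>, and the
  factor \<open>cnj (z a)\<close> disappears in the modulus. The column index determines the row
  index through the inverse of \<open>\<sigma>\<close>.\<close>

lemma char_mat_affine:
  assumes fin: "finite (carrier G)"
    and \<pi>: "bij_betw \<pi> (carrier (dual_group G)) (carrier (dual_group G))"
    and \<sigma>: "\<sigma> \<in> auto G" and z: "z \<in> carrier (dual_group G)"
    and eq: "\<forall>x\<in>carrier (dual_group G). \<pi> x = z \<otimes>\<^bsub>dual_group G\<^esub> dual_auto G \<sigma> x"
  shows "eq_mat (carrier G) (carrier G) (char_mat G \<pi>) (perm_mat (inv_into (carrier G) \<sigma>))"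
  unfolding eq_mat_def
proof (intro ballI)
  fix a b assume ab: "a \<in> carrier G" "b \<in> carrier G"
  let ?D = "carrier (dual_group G)"
  have bij: "bij_betw \<sigma> (carrier G) (carrier G)"
    using \<sigma> by (simp add: auto_def Bij_def)
  then have \<sigma>a: "\<sigma> a \<in> carrier G"
    using ab by (auto simp: bij_betw_def)
  have n: "order G > 0"
    using fin by (simp add: order_gt_0_iff_finite)
  have "\<pi> x a = z a * x (\<sigma> a)" if "x \<in> ?D" for x
    using eq dual_affine_iff[OF \<sigma> z that, of "\<pi> x"] \<pi> ab that by (auto simp: bij_betw_def)
  then have "(\<Sum>x\<in>?D. x b * cnj (\<pi> x a)) = cnj (z a) * (\<Sum>x\<in>?D. x b * cnj (x (\<sigma> a)))"
    by (simp add: sum_distrib_left mult_ac)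
  also have "\<dots> = (if b = \<sigma> a then cnj (z a) * of_nat (order G) else 0)"
    using fin ab \<sigma>a by (simp add: dual_orthogonal_columns)
  finally have "char_mat G \<pi> a b = (if b = \<sigma> a then 1 else 0)"
    using fin \<pi> ab z n by (simp add: char_mat_apply norm_mult dual_norm)
  moreover have "b = \<sigma> a \<longleftrightarrow> a = inv_into (carrier G) \<sigma> b"
    using bij ab by (auto simp: bij_betw_inv_into_left bij_betw_inv_into_right)
  ultimately show "char_mat G \<pi> a b = perm_mat (inv_into (carrier G) \<sigma>) a b"
    by (simp add: perm_mat_def)
qed

lemma perm_char_mat_imp_affine:
  assumes fin: "finite (carrier G)"
    and \<pi>: "bij_betw \<pi> (carrier (dual_group G)) (carrier (dual_group G))"
    and perm: "is_perm_mat (carrier G) (char_mat G \<pi>)"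
  shows "\<exists>\<sigma>\<in>auto G. \<exists>z\<in>carrier (dual_group G).
    \<forall>x\<in>carrier (dual_group G). \<pi> x = z \<otimes>\<^bsub>dual_group G\<^esub> dual_auto G \<sigma> x"
proof -
  let ?D = "carrier (dual_group G)" and ?\<epsilon> = "\<one>\<^bsub>dual_group G\<^esub>"
  interpret D: comm_group "dual_group G"
    by (rule comm_group_dual_group)
  have n: "order G > 0"
    using fin by (simp add: order_gt_0_iff_finite)
  have \<pi>D: "\<pi> x \<in> ?D" if "x \<in> ?D" for x
    using \<pi> that by (auto simp: bij_betw_def)
  obtain \<rho> where \<rho>: "bij_betw \<rho> (carrier G) (carrier G)"
    and mat: "\<And>a b. \<lbrakk>a \<in> carrier G; b \<in> carrier G\<rbrakk> \<Longrightarrow> char_mat G \<pi> a b = (if a = \<rho> b then 1 else 0)"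
    using perm by (auto simp: is_perm_mat_def eq_mat_def perm_mat_def)
  \<comment> \<open>The ones stand at \<open>(\<rho> b, b)\<close>, while the affine form reads off
    the column from the row; hence the inverse. It is restricted because elements of
    \<open>auto G\<close> are extensional.\<close>
  define \<sigma> where "\<sigma> = restrict (inv_into (carrier G) \<rho>) (carrier G)"
  have bij: "bij_betw \<sigma> (carrier G) (carrier G)"
    unfolding \<sigma>_def using \<rho> by (subst bij_betw_restrict_eq) (rule bij_betw_inv_into)
  have \<sigma>G: "\<sigma> a \<in> carrier G" if "a \<in> carrier G" for a
    using bij that by (auto simp: bij_betw_def)
  have \<rho>\<sigma>: "\<rho> (\<sigma> a) = a" if "a \<in> carrier G" for a
    using \<rho> that by (simp add: \<sigma>_def bij_betw_inv_into_right)
  \<comment> \<open>At the trivial character the automorphism part is trivial, which forces this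
    value of \<open>z\<close>.\<close>
  define z where "z = \<pi> ?\<epsilon>"
  have z: "z \<in> ?D"
    by (simp add: z_def \<pi>D)
  have aff: "\<pi> x a = z a * x (\<sigma> a)" if x: "x \<in> ?D" and a: "a \<in> carrier G" for x a
  proof -
    let ?f = "\<lambda>x. x (\<sigma> a) * cnj (\<pi> x a)"
    \<comment> \<open>The entry at \<open>(a, \<sigma> a)\<close> is 1, so this sum of unimodular
      numbers has the largest possible modulus and its terms are all equal.\<close>
    have "cmod (sum ?f ?D) / real (order G) = 1"
      using char_mat_apply[OF fin \<pi> a \<sigma>G[OF a]] mat[OF a \<sigma>G[OF a]] \<rho>\<sigma>[OF a]
      using n by (auto simp: abs_square_eq_1)
    then have S: "cmod (sum ?f ?D) = real (card ?D)"
      using n fin by (simp add: card_dual_group)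
    have unit: "cmod (?f x) = 1" if "x \<in> ?D" for x
      using that a by (simp add: norm_mult dual_norm \<pi>D \<sigma>G)
    have const: "?f x = sum ?f ?D / of_nat (card ?D)" if "x \<in> ?D" for x
      by (rule cmod_sum_eq_card_imp_const [OF finite_dual_group [OF fin] unit S that])
    \<comment> \<open>Comparison with the term of the trivial character identifies the common value
      as \<open>cnj (z a)\<close>.\<close>
    have "?f x = ?f ?\<epsilon>"
      using const[OF x] const[OF D.one_closed] by metis
    then have f: "?f x = cnj (z a)"
      using a by (simp add: dual_one_apply \<sigma>G z_def)
    have "z a * x (\<sigma> a) * (\<pi> x a * cnj (\<pi> x a)) = (z a * ?f x) * \<pi> x a"
      by (simp only: mult_ac)
    also have "\<dots> = (z a * cnj (z a)) * \<pi> x a"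
      by (simp only: f)
    finally show ?thesis
      using a x z by (simp add: dual_mult_cnj \<pi>D)
  qed
  \<comment> \<open>Multiplicativity is tested against every character \<open>x\<close>: both
    \<open>\<pi> x\<close> and \<open>z\<close> are multiplicative, and the nonzero value of
    \<open>z\<close> cancels.\<close>
  have "\<sigma> (a \<otimes> b) = \<sigma> a \<otimes> \<sigma> b" if ab: "a \<in> carrier G" "b \<in> carrier G" for a b
  proof (rule dual_separates [OF fin])
    fix x assume x: "x \<in> ?D"
    have "z (a \<otimes> b) * x (\<sigma> (a \<otimes> b)) = (z a * x (\<sigma> a)) * (z b * x (\<sigma> b))"
      using x ab by (simp add: aff [symmetric] dual_mult \<pi>D)
    also have "\<dots> = z (a \<otimes> b) * x (\<sigma> a \<otimes> \<sigma> b)"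
      using x z ab by (simp add: dual_mult \<sigma>G mult_ac)
    finally show "x (\<sigma> (a \<otimes> b)) = x (\<sigma> a \<otimes> \<sigma> b)"
      using dual_norm[OF z, of "a \<otimes> b"] ab by auto
  qed (use ab \<sigma>G in auto)
  then have \<sigma>: "\<sigma> \<in> auto G"
    using bij \<sigma>G by (auto simp: auto_def Bij_def hom_def \<sigma>_def)
  have "\<pi> x = z \<otimes>\<^bsub>dual_group G\<^esub> dual_auto G \<sigma> x" if "x \<in> ?D" for x
    unfolding dual_affine_iff[OF \<sigma> z that \<pi>D[OF that]] using aff[OF that] by blast
  with \<sigma> z show ?thesis
    by blast
qed

end

theorem theorem4p6:
  fixes G :: "('a, 'm) monoid_scheme" (structure)
    and \<pi> :: "('a \<Rightarrow> complex) \<Rightarrow> ('a \<Rightarrow> complex)"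
  assumes "comm_group G" and "finite (carrier G)"
    and "bij_betw \<pi> (carrier (dual_group G)) (carrier (dual_group G))"
  shows
    "(entries_commute (carrier G) (carrier (dual_group G)) (qperm_mat G \<pi>)
        \<longleftrightarrow> (\<exists>\<sigma>\<in>auto G. \<exists>z\<in>carrier (dual_group G).
              \<forall>x\<in>carrier (dual_group G). \<pi> x = z \<otimes>\<^bsub>dual_group G\<^esub> dual_auto G \<sigma> x))
     \<and> ((\<exists>\<sigma>\<in>auto G. \<exists>z\<in>carrier (dual_group G).
              \<forall>x\<in>carrier (dual_group G). \<pi> x = z \<otimes>\<^bsub>dual_group G\<^esub> dual_auto G \<sigma> x)
        \<longleftrightarrow> is_perm_mat (carrier G) (char_mat G \<pi>))
     \<and> (\<forall>\<sigma>\<in>auto G. \<forall>z\<in>carrier (dual_group G).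
          (\<forall>x\<in>carrier (dual_group G). \<pi> x = z \<otimes>\<^bsub>dual_group G\<^esub> dual_auto G \<sigma> x)
          \<longrightarrow> eq_mat (carrier G) (carrier G) (char_mat G \<pi>) (perm_mat (inv_into (carrier G) \<sigma>))
            \<and> eq_mat (carrier G) (carrier G)
                (perm_mat (inv_into (carrier G) \<sigma>) :: 'a \<Rightarrow> 'a \<Rightarrow> real) (mat_transp (perm_mat \<sigma>)))"
proof -
  interpret comm_group G by fact
  let ?aff = "\<exists>\<sigma>\<in>auto G. \<exists>z\<in>carrier (dual_group G).
    \<forall>x\<in>carrier (dual_group G). \<pi> x = z \<otimes>\<^bsub>dual_group G\<^esub> dual_auto G \<sigma> x"
  \<comment> \<open>Both matrices have their ones where the column index is the image of the row
    index under \<open>\<sigma>\<close>.\<close>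
  have transp: "eq_mat (carrier G) (carrier G)
      (perm_mat (inv_into (carrier G) \<sigma>) :: 'a \<Rightarrow> 'a \<Rightarrow> real) (mat_transp (perm_mat \<sigma>))"
    if "\<sigma> \<in> auto G" for \<sigma>
  proof -
    have "bij_betw \<sigma> (carrier G) (carrier G)"
      using that by (simp add: auto_def Bij_def)
    then show ?thesis
      by (auto simp: eq_mat_def perm_mat_def mat_transp_def
          bij_betw_inv_into_left bij_betw_inv_into_right)
  qed
  have "is_perm_mat (carrier G) (char_mat G \<pi>)" if aff: ?aff
  proof -
    obtain \<sigma> where "\<sigma> \<in> auto G"
      and "eq_mat (carrier G) (carrier G) (char_mat G \<pi>) (perm_mat (inv_into (carrier G) \<sigma>))"
      using aff char_mat_affine[OF assms(2,3)] by blast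
    then show ?thesis
      unfolding is_perm_mat_def by (auto simp: auto_def Bij_def intro: bij_betw_inv_into)
  qed
  then have perm: "?aff \<longleftrightarrow> is_perm_mat (carrier G) (char_mat G \<pi>)"
    using perm_char_mat_imp_affine[OF assms(2,3)] by blast
  \<comment> \<open>Condition (1) is linked to (2) through (3): commutation and the permutation
    property both say that the characteristic matrix has entries 0 and 1.\<close>
  moreover have "entries_commute (carrier G) (carrier (dual_group G)) (qperm_mat G \<pi>) \<longleftrightarrow> ?aff"
    using perm entries_commute_iff_char_mat[OF assms(2,3)] is_perm_mat_char_mat_iff[OF assms(2,3)]
    by simp
  ultimately show ?thesis
    by (intro conjI ballI impI char_mat_affine[OF assms(2,3)] transp) (assumption | erule (1) bspec)+
qed

end
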